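(* Let $a,b,c,d\in\mathbb R$ be admissible parameters (see context) with $c\ne0$, let $m\in(0,1]$ and $\tau_1,\tau_2\in\{1,-1\}$. Assume that $$ac(b-6d)(3b-2d)<0,\qquad c(2m^2-1)(b+2d)(3b+2d)<0,$$ and $(2m^2-1)(3b+2d)(b-d)\ge 0$ with equality only when $b=d$. Define $$j_0=-\frac{a(3b+2d)(21b-46d)+2c(3b-2d)(b-6d)}{2c(3b-2d)(b-6d)},$$ $$j_1=-\tau_1\tau_2\frac{12\,a\,m\,(3b+2d)\sqrt{(2m^2-1)(3b+2d)(b-d)}}{c(b-6d)(3b-2d)(2m^2-1)},\qquad j_2=\frac{9am^2(3b+2d)}{c(3b-2d)(2m^2-1)},$$ $$k_0=\tau_1\frac{(21b+8c+14d)\sqrt{-2ac(b-6d)(3b-2d)}}{2c(b-6d)(3b-2d)},$$ $$k_1=\tau_2\frac{6m\sqrt{-2ac(b-6d)(3b-2d)(2m^2-1)(3b+2d)(b-d)}}{c(2m^2-1)(b-6d)(3b-2d)},$$ $$k_2=-\tau_1\frac{9m^2(3b+2d)\sqrt{-2ac(b-6d)(3b-2d)}}{c(2m^2-1)(b-6d)(3b-2d)},$$ $$\lambda=\frac12\sqrt{\frac{-6(3b+2d)}{c(2m^2-1)(b+2d)}},\qquad \sigma=\tau_1\frac{4\sqrt{-2ac(b-6d)(3b-2d)}}{(b-6d)(3b-2d)}.$$ Then, with $\xi=x-\sigma t$, the functions $$\eta=j_0+j_1\mathrm{cn}(\lambda\xi,m)+j_2\mathrm{cn}^2(\lambda\xi,m),\qquad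 w=k_0+k_1\mathrm{cn}(\lambda\xi,m)+k_2\mathrm{cn}^2(\lambda\xi,m)$$ form a traveling-wave solution of the $abcd$-system.
   Context: The $abcd$-system for real-valued $\eta(x,t),w(x,t)$, $x,t\in\mathbb R$, is $$\eta_t+w_x+(w\eta)_x+a w_{xxx}-b\eta_{xxt}=0,\qquad w_t+\eta_x+ww_x+c\,\eta_{xxx}-d w_{xxt}=0 .$$ The real parameters $a,b,c,d$ are admissible if for some $\theta\in[0,1]$: $a+b=\tfrac12(\theta^2-\tfrac13)$, $c+d=\tfrac12(1-\theta^2)\ge 0$, and $a+b+c+d=\tfrac13$. Jacobi elliptic function convention: for $0\le m\le 1$, with $v=\int_0^\phi (1-m^2\sin^2 t)^{-1/2}dt$, one sets $\mathrm{cn}(v,m)=\cos\phi$; $m$ is the elliptic modulus (so $\mathrm{cn}(v,1)=\mathrm{sech}\,v$). *)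

theory Defs
  imports "HOL-Analysis.Analysis"
begin

definition jacobi_integrand :: "real \<Rightarrow> real \<Rightarrow> real" where
  "jacobi_integrand m t = 1 / sqrt (1 - m\<^sup>2 * (sin t)\<^sup>2)"

(* The second argument is the elliptic modulus m, not the parameter m^2. The interval integral is
   oriented, so negative v is covered. The integrability condition is needed because a divergent
   integral has value 0: for m = 1 it confines phi to the open interval from -pi/2 to pi/2. *)
definition jacobi_am :: "real \<Rightarrow> real \<Rightarrow> real" where
  "jacobi_am v m = (THE \<phi>. interval_lebesgue_integrable lborel (ereal 0) (ereal \<phi>) (jacobi_integrand m)
      \<and> (LBINT t=ereal 0..ereal \<phi>. jacobi_integrand m t) = v)"

definition jacobi_cn :: "real \<Rightarrow> real \<Rightarrow> real" where
  "jacobi_cn v m = cos (jacobi_am v m)"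

definition admissible :: "real \<Rightarrow> real \<Rightarrow> real \<Rightarrow> real \<Rightarrow> bool" where
  "admissible a b c d \<longleftrightarrow> (\<exists>\<theta>. 0 \<le> \<theta> \<and> \<theta> \<le> 1
      \<and> a + b = 1/2 * (\<theta>\<^sup>2 - 1/3)
      \<and> c + d = 1/2 * (1 - \<theta>\<^sup>2) \<and> 1/2 * (1 - \<theta>\<^sup>2) \<ge> 0
      \<and> a + b + c + d = 1/3)"

definition partial_x :: "(real \<Rightarrow> real \<Rightarrow> real) \<Rightarrow> real \<Rightarrow> real \<Rightarrow> real" where
  "partial_x u x t = deriv (\<lambda>s. u s t) x"

definition partial_t :: "(real \<Rightarrow> real \<Rightarrow> real) \<Rightarrow> real \<Rightarrow> real \<Rightarrow> real" where
  "partial_t u x t = deriv (\<lambda>s. u x s) t"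

(* u is of class C^k on the plane *)
primrec Ck_plane :: "nat \<Rightarrow> (real \<Rightarrow> real \<Rightarrow> real) \<Rightarrow> bool" where
  "Ck_plane 0 u \<longleftrightarrow> continuous_on UNIV (\<lambda>(x, t). u x t)"
| "Ck_plane (Suc k) u \<longleftrightarrow>
     (\<forall>x t. (\<lambda>s. u s t) differentiable at x \<and> (\<lambda>s. u x s) differentiable at t)
     \<and> Ck_plane k (partial_x u) \<and> Ck_plane k (partial_t u)"

(* Classical solutions: since deriv is total, the regularity has to be required explicitly. *)
definition abcd_solution ::
  "real \<Rightarrow> real \<Rightarrow> real \<Rightarrow> real \<Rightarrow> (real \<Rightarrow> real \<Rightarrow> real) \<Rightarrow> (real \<Rightarrow> real \<Rightarrow> real) \<Rightarrow> bool" where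
  "abcd_solution a b c d \<eta> w \<longleftrightarrow> Ck_plane 3 \<eta> \<and> Ck_plane 3 w \<and>
     (\<forall>x t.
        partial_t \<eta> x t + partial_x w x t + partial_x (\<lambda>x t. w x t * \<eta> x t) x t
          + a * partial_x (partial_x (partial_x w)) x t
          - b * partial_t (partial_x (partial_x \<eta>)) x t = 0
      \<and> partial_t w x t + partial_x \<eta> x t + w x t * partial_x w x t
          + c * partial_x (partial_x (partial_x \<eta>)) x t
          - d * partial_t (partial_x (partial_x w)) x t = 0)"

definition travelling_wave_solution ::
  "real \<Rightarrow> real \<Rightarrow> real \<Rightarrow> real \<Rightarrow> real \<Rightarrow> (real \<Rightarrow> real \<Rightarrow> real) \<Rightarrow> (real \<Rightarrow> real \<Rightarrow> real) \<Rightarrow> bool" where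
  "travelling_wave_solution a b c d \<sigma> \<eta> w \<longleftrightarrow>
     (\<exists>f g. \<forall>x t. \<eta> x t = f (x - \<sigma> * t) \<and> w x t = g (x - \<sigma> * t))
     \<and> abcd_solution a b c d \<eta> w"

end

theory Submission
  imports Defs
begin

text \<open>
  The amplitude is the inverse of the incomplete elliptic integral \<open>E\<close>; since the integrand is at
  least 1, \<open>E\<close> is expanding, so its inverse is 1-Lipschitz and hence differentiable, and \<open>u = cn\<close>
  satisfies \<open>u'\<^sup>2 = (1 - u\<^sup>2) (1 - m\<^sup>2 + m\<^sup>2 u\<^sup>2)\<close>. For a profile that is quadratic in \<open>u\<close>, each equation
  of the system becomes \<open>u'\<close> times a cubic polynomial in \<open>u\<close>, so there are eight coefficients that
  have to vanish. With \<open>a = - \<sigma>\<^sup>2 (b - 6 d) (3 b - 2 d) / (32 c)\<close> and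
  \<open>X = \<tau>1 \<tau>2 sqrt (M P (b - d)) / M\<close>, where \<open>M = 2 m\<^sup>2 - 1\<close> and \<open>P = 3 b + 2 d\<close>, all data become
  rational in \<open>\<sigma>\<close> and \<open>X\<close>, and the coefficients vanish identically modulo \<open>X\<^sup>2 = P (b - d) / M\<close>.
\<close>

section \<open>Travelling profiles\<close>

text \<open>The conclusions are equations between functions, so that they can rewrite inside
  iterated partial derivatives.\<close>

lemma partial_travelling:
  assumes "\<And>y. (f has_real_derivative f' y) (at y)"
  shows "partial_x (\<lambda>x t. f (x - s * t)) = (\<lambda>x t. f' (x - s * t))"
    and "partial_t (\<lambda>x t. f (x - s * t)) = (\<lambda>x t. - s * f' (x - s * t))"
proof -
  have "((\<lambda>r. f (r - s * t)) has_real_derivative f' (x - s * t) * 1) (at x)" for x t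
    by (rule DERIV_chain2[OF assms]) (auto intro!: derivative_eq_intros)
  then show "partial_x (\<lambda>x t. f (x - s * t)) = (\<lambda>x t. f' (x - s * t))"
    unfolding partial_x_def by (intro ext DERIV_imp_deriv) simp
  have "((\<lambda>r. f (x - s * r)) has_real_derivative f' (x - s * t) * (- s)) (at t)" for x t
    by (rule DERIV_chain2[OF assms]) (auto intro!: derivative_eq_intros)
  then show "partial_t (\<lambda>x t. f (x - s * t)) = (\<lambda>x t. - s * f' (x - s * t))"
    unfolding partial_t_def by (intro ext DERIV_imp_deriv) (simp add: mult.commute)
qed

text \<open>The factor \<open>K\<close> makes the induction work: differentiation in
  \<open>t\<close> brings out \<open>- s\<close>, so both partial derivatives are constant multiples
  of the next profile \<open>H 1\<close> and fall under the claim for the shifted sequence.\<close>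

lemma Ck_plane_travelling:
  assumes "\<And>i y. i < k \<Longrightarrow> (H i has_real_derivative H (Suc i) y) (at y)"
    and "continuous_on UNIV (H k)"
  shows "Ck_plane k (\<lambda>x t. K * H 0 (x - s * t))"
  using assms
proof (induction k arbitrary: H K)
  case 0
  have "continuous_on UNIV (\<lambda>p. H 0 (fst p - s * snd p))"
    by (rule continuous_on_compose2[OF 0(2)]) (auto intro!: continuous_intros)
  then show ?case
    by (simp add: case_prod_unfold continuous_on_mult_left)
next
  case (Suc k)
  have d: "((\<lambda>y. L * H 0 y) has_real_derivative L * H 1 y) (at y)" for y L
    using Suc.prems(1)[of 0 y] by (auto intro!: derivative_eq_intros)
  have diff: "H 0 differentiable at y" for y
    using Suc.prems(1)[of 0 y] real_differentiable_def by blast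
  have "Ck_plane k (\<lambda>x t. L * H (Suc 0) (x - s * t))" for L
    using Suc.prems by (intro Suc.IH[of "\<lambda>i. H (Suc i)" L]) auto
  moreover have "(\<lambda>x. K * H 0 (x - s * t)) differentiable at x"
      "(\<lambda>t. K * H 0 (x - s * t)) differentiable at t" for x t
    by (intro differentiable_mult differentiable_const
        differentiable_compose[where f = "H 0", OF diff] differentiable_diff differentiable_ident)+
  moreover have "partial_x (\<lambda>x t. K * H 0 (x - s * t)) = (\<lambda>x t. K * H (Suc 0) (x - s * t))"
      "partial_t (\<lambda>x t. K * H 0 (x - s * t)) = (\<lambda>x t. (- s * K) * H (Suc 0) (x - s * t))"
    using partial_travelling[OF d, of K s] by (simp_all add: mult.assoc)
  ultimately show ?case
    by (simp only: Ck_plane.simps) blast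
qed

section \<open>The amplitude function\<close>

lemma jacobi_integrand_ge_1:
  assumes "0 < 1 - m\<^sup>2 * (sin t)\<^sup>2"
  shows "1 \<le> jacobi_integrand m t"
  using assms unfolding jacobi_integrand_def by (simp add: real_le_rsqrt)

lemma isCont_jacobi_integrand:
  assumes "0 < 1 - m\<^sup>2 * (sin t)\<^sup>2"
  shows "isCont (jacobi_integrand m) t"
  using assms unfolding jacobi_integrand_def[abs_def] by (intro continuous_intros) auto

text \<open>The interval \<open>I\<close> is kept arbitrary so that one argument serves the whole
  line for \<open>m < 1\<close> and the open interval from \<open>- pi/2\<close> to
  \<open>pi/2\<close> for \<open>m = 1\<close>.\<close>

lemma interval_integral_jacobi_integrand:
  assumes I: "is_interval I" "0 \<in> I" "\<phi> \<in> I"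
    and pos: "\<And>t. t \<in> I \<Longrightarrow> 0 < 1 - m\<^sup>2 * (sin t)\<^sup>2"
    and E: "\<And>t. t \<in> I \<Longrightarrow> (E has_real_derivative jacobi_integrand m t) (at t)" "E 0 = 0"
  shows "interval_lebesgue_integrable lborel (ereal 0) (ereal \<phi>) (jacobi_integrand m)"
    and "(LBINT t=ereal 0..ereal \<phi>. jacobi_integrand m t) = E \<phi>"
proof -
  have mem: "t \<in> I" if "min 0 \<phi> \<le> t" "t \<le> max 0 \<phi>" for t
    using that I mem_is_interval_1_I[of I 0 \<phi> t] mem_is_interval_1_I[of I \<phi> 0 t]
    by (auto simp: min_def max_def split: if_splits)
  then have cont: "isCont (jacobi_integrand m) t" if "min 0 \<phi> \<le> t" "t \<le> max 0 \<phi>" for t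
    using that pos isCont_jacobi_integrand by blast
  then show "interval_lebesgue_integrable lborel (ereal 0) (ereal \<phi>) (jacobi_integrand m)"
    by (intro interval_integrable_isCont) (auto simp: min_def max_def split: if_splits)
  have "(LBINT t=ereal 0..ereal \<phi>. jacobi_integrand m t) = E \<phi> - E 0"
  proof (rule interval_integral_FTC_finite)
    show "continuous_on {min 0 \<phi>..max 0 \<phi>} (jacobi_integrand m)"
      using cont by (intro continuous_at_imp_continuous_on) auto
    show "(E has_vector_derivative jacobi_integrand m t) (at t within {min 0 \<phi>..max 0 \<phi>})"
      if "min 0 \<phi> \<le> t" "t \<le> max 0 \<phi>" for t
      using E(1)[OF mem[OF that]]
      by (metis has_real_derivative_iff_has_vector_derivative has_vector_derivative_at_within)
  qed
  then show "(LBINT t=ereal 0..ereal \<phi>. jacobi_integrand m t) = E \<phi>"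
    using E(2) by simp
qed

text \<open>On \<open>I\<close> the slope of \<open>E\<close> is at least 1, so \<open>E\<close> is
  injective with a 1-Lipschitz inverse, and this continuity is what the inverse function rule
  requires. The hypothesis \<open>intble\<close> keeps points outside \<open>I\<close> out of the
  definite description, which ranges over all reals.\<close>

lemma jacobi_am_antiderivative:
  assumes I: "is_interval I" "0 \<in> I"
    and pos: "\<And>t. t \<in> I \<Longrightarrow> 0 < 1 - m\<^sup>2 * (sin t)\<^sup>2"
    and E: "\<And>t. t \<in> I \<Longrightarrow> (E has_real_derivative jacobi_integrand m t) (at t)" "E 0 = 0"
    and surj: "\<And>v. \<exists>\<phi>\<in>I. E \<phi> = v"
    and intble: "\<And>\<phi>. interval_lebesgue_integrable lborel (ereal 0) (ereal \<phi>) (jacobi_integrand m)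
                  \<Longrightarrow> \<phi> \<in> I"
  shows "jacobi_am v m \<in> I"
    and "((\<lambda>v. jacobi_am v m) has_real_derivative sqrt (1 - m\<^sup>2 * (sin (jacobi_am v m))\<^sup>2)) (at v)"
proof -
  have lt: "y - x \<le> E y - E x" if "x < y" "x \<in> I" "y \<in> I" for x y
  proof -
    have mem: "t \<in> I" if "x \<le> t" "t \<le> y" for t
      using that \<open>x \<in> I\<close> \<open>y \<in> I\<close> I(1) mem_is_interval_1_I by blast
    obtain z where "x < z" "z < y" "E y - E x = (y - x) * jacobi_integrand m z"
      using MVT2[of x y E "jacobi_integrand m"] \<open>x < y\<close> E(1) mem by blast
    with jacobi_integrand_ge_1[OF pos[OF mem[of z]]] show ?thesis
      using mult_left_mono[of 1 "jacobi_integrand m z" "y - x"] by auto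
  qed
  then have expand: "\<bar>x - y\<bar> \<le> \<bar>E x - E y\<bar>" if "x \<in> I" "y \<in> I" for x y
    using that lt[of x y] lt[of y x] by linarith
  have am: "jacobi_am v m \<in> I \<and> E (jacobi_am v m) = v" for v
  proof -
    obtain \<phi> where \<phi>: "\<phi> \<in> I" "E \<phi> = v" using surj by blast
    have "jacobi_am v m = \<phi>"
      unfolding jacobi_am_def
    proof (rule the_equality)
      show "interval_lebesgue_integrable lborel (ereal 0) (ereal \<phi>) (jacobi_integrand m)
          \<and> (LBINT t=ereal 0..ereal \<phi>. jacobi_integrand m t) = v"
        using interval_integral_jacobi_integrand[of I \<phi> m E] I pos E \<phi> by auto
      fix \<psi>
      assume \<psi>: "interval_lebesgue_integrable lborel (ereal 0) (ereal \<psi>) (jacobi_integrand m)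
          \<and> (LBINT t=ereal 0..ereal \<psi>. jacobi_integrand m t) = v"
      then have "\<psi> \<in> I" using intble by blast
      moreover from this have "E \<psi> = v"
        using interval_integral_jacobi_integrand(2)[of I \<psi> m E] I pos E \<psi> by auto
      ultimately show "\<psi> = \<phi>" using expand[of \<psi> \<phi>] \<phi> by auto
    qed
    with \<phi> show ?thesis by simp
  qed
  then show "jacobi_am v m \<in> I" by blast
  have lip: "dist (jacobi_am x m) (jacobi_am y m) \<le> dist x y" for x y
    using expand[of "jacobi_am x m" "jacobi_am y m"] am by (simp add: dist_real_def)
  have "isCont (\<lambda>v. jacobi_am v m) v"
    unfolding continuous_at_eps_delta using lip by (meson le_less_trans)
  moreover have "jacobi_integrand m (jacobi_am v m) \<noteq> 0"
    using jacobi_integrand_ge_1[OF pos, of "jacobi_am v m"] am[of v] by linarith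
  \<comment> \<open>The endpoints \<open>v - 1\<close> and \<open>v + 1\<close> are arbitrary, since
    \<open>E (jacobi_am v m) = v\<close> holds for every \<open>v\<close>.\<close>
  ultimately have "((\<lambda>v. jacobi_am v m) has_real_derivative
      inverse (jacobi_integrand m (jacobi_am v m))) (at v)"
    using am E(1) by (intro DERIV_inverse_function[where f = E and a = "v - 1" and b = "v + 1"]) auto
  then show "((\<lambda>v. jacobi_am v m) has_real_derivative
      sqrt (1 - m\<^sup>2 * (sin (jacobi_am v m))\<^sup>2)) (at v)"
    by (simp add: jacobi_integrand_def)
qed

section \<open>The degenerate modulus 1\<close>

text \<open>The unsimplified \<open>1\<^sup>2\<close> lets the first fact match the positivity
  condition of the general lemmas at \<open>m = 1\<close>.\<close>

lemma cos_pos_imp_modulus_1: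
  assumes "0 < cos t"
  shows "0 < 1 - 1\<^sup>2 * (sin t)\<^sup>2" and "jacobi_integrand 1 t = 1 / cos t"
proof -
  have "1 - 1\<^sup>2 * (sin t)\<^sup>2 = (cos t)\<^sup>2" by (simp add: cos_squared_eq)
  then show "0 < 1 - 1\<^sup>2 * (sin t)\<^sup>2" "jacobi_integrand 1 t = 1 / cos t"
    using assms by (auto simp: jacobi_integrand_def)
qed

text \<open>\<open>arsinh (tan t)\<close> is the inverse Gudermannian function, the classical
  antiderivative of the secant; its inverse is \<open>arctan (sinh v)\<close>.\<close>

lemma arsinh_tan_has_derivative:
  assumes "0 < cos t"
  shows "((\<lambda>t. arsinh (tan t)) has_real_derivative jacobi_integrand 1 t) (at t)"
proof -
  have "(tan t)\<^sup>2 + 1 = (1 / cos t)\<^sup>2"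
    using assms tan_sec[of t] by (simp add: inverse_eq_divide power_one_over add.commute)
  then have "sqrt ((tan t)\<^sup>2 + 1) = 1 / cos t"
    using assms by (metis divide_pos_pos less_eq_real_def real_sqrt_unique zero_less_one)
  moreover have "((\<lambda>t. arsinh (tan t)) has_real_derivative
      1 / sqrt ((tan t)\<^sup>2 + 1) * inverse ((cos t)\<^sup>2)) (at t)"
    using assms by (intro DERIV_chain2[OF arsinh_real_has_field_derivative] DERIV_tan) auto
  ultimately show ?thesis
    using assms by (simp add: cos_pos_imp_modulus_1 power2_eq_square field_simps)
qed

lemma integral_modulus_1_arctan_sinh:
  "interval_lebesgue_integrable lborel (ereal 0) (ereal (arctan (sinh v))) (jacobi_integrand 1)"
  "(LBINT t=ereal 0..ereal (arctan (sinh v)). jacobi_integrand 1 t) = v"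
proof -
  have I: "is_interval {- pi/2 <..< pi/2}" "0 \<in> {- pi/2 <..< pi/2}"
      "arctan (sinh v) \<in> {- pi/2 <..< pi/2}"
    using arctan_bounded[of "sinh v"] by (auto simp: is_interval_1)
  have c: "0 < cos t" if "t \<in> {- pi/2 <..< pi/2}" for t
    using that by (intro cos_gt_zero_pi) auto
  note * = interval_integral_jacobi_integrand[OF I cos_pos_imp_modulus_1(1)[OF c]
      arsinh_tan_has_derivative[OF c]]
  show "interval_lebesgue_integrable lborel (ereal 0) (ereal (arctan (sinh v))) (jacobi_integrand 1)"
    "(LBINT t=ereal 0..ereal (arctan (sinh v)). jacobi_integrand 1 t) = v"
    using * by (simp_all add: tan_arctan arsinh_sinh_real)
qed

text \<open>Taking absolute values removes the orientation, so that integrals to positive and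
  negative endpoints can be compared through inclusion of sets.\<close>

lemma interval_integral_abs:
  fixes f :: "real \<Rightarrow> real" and u :: real
  assumes "\<And>t. 0 \<le> f t"
  shows "\<bar>LBINT t=ereal 0..ereal u. f t\<bar> = (LINT t:einterval (min 0 u) (max 0 u)|lborel. f t)"
proof -
  have "0 \<le> (LINT t:A|lborel. f t)" for A
    unfolding set_lebesgue_integral_def
    by (rule Bochner_Integration.integral_nonneg) (simp add: assms)
  then show ?thesis
    by (auto simp: interval_lebesgue_integral_def min_def max_def)
qed

text \<open>The secant has a divergent integral at the points \<open>- pi/2\<close> and
  \<open>pi/2\<close>: if the integral up to some \<open>\<phi>\<close> beyond them existed, it
  would dominate the integrals up to \<open>arctan (sinh v)\<close>, whose absolute values
  \<open>\<bar>v\<bar>\<close> are unbounded.\<close>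

lemma integrable_modulus_1:
  assumes "interval_lebesgue_integrable lborel (ereal 0) (ereal \<phi>) (jacobi_integrand 1)"
  shows "\<phi> \<in> {- pi/2 <..< pi/2}"
proof (rule ccontr)
  assume out: "\<phi> \<notin> {- pi/2 <..< pi/2}"
  \<comment> \<open>The radicand is the square of the cosine; where it vanishes, the integrand has
    the default value \<open>1 / 0 = 0\<close>.\<close>
  have nonneg: "0 \<le> jacobi_integrand 1 t" for t
    by (simp add: jacobi_integrand_def cos_squared_eq[symmetric])
  define A where "A u = einterval (ereal (min 0 u)) (ereal (max 0 u))" for u :: real
  have int: "set_integrable lborel (A u) (jacobi_integrand 1)"
    if "interval_lebesgue_integrable lborel (ereal 0) (ereal u) (jacobi_integrand 1)" for u
    using that unfolding A_def interval_lebesgue_integrable_def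
    by (auto simp: min_def max_def split: if_splits)
  define K where "K = \<bar>LBINT t=ereal 0..ereal \<phi>. jacobi_integrand 1 t\<bar>"
  \<comment> \<open>The sign places \<open>u\<close> on the same side of 0 as \<open>\<phi>\<close>,
    and the size makes the integral up to \<open>u\<close> exceed the supposed bound
    \<open>K\<close>.\<close>
  define v where "v = sgn \<phi> * (K + 1)"
  define u where "u = arctan (sinh v)"
  have "\<phi> \<noteq> 0" using out by auto
  then have v: "\<bar>v\<bar> = K + 1" by (simp add: v_def K_def abs_mult abs_sgn_eq)
  have "A u \<subseteq> A \<phi>"
  proof (cases "\<phi> > 0")
    case True
    then have "v > 0" by (simp add: v_def K_def)
    then have "u > 0" by (simp add: u_def)
    then show ?thesis using True out arctan_bounded[of "sinh v"]
      by (auto simp: A_def u_def einterval_def)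
  next
    case False
    then have "v < 0" using \<open>\<phi> \<noteq> 0\<close> by (simp add: v_def K_def)
    then have "u < 0" by (simp add: u_def)
    then show ?thesis using False out arctan_bounded[of "sinh v"]
      by (auto simp: A_def u_def einterval_def)
  qed
  then have "(LINT t:A u|lborel. jacobi_integrand 1 t) \<le> (LINT t:A \<phi>|lborel. jacobi_integrand 1 t)"
    using int[OF assms] int[OF integral_modulus_1_arctan_sinh(1)[of v, folded u_def]] nonneg
    unfolding set_lebesgue_integral_def set_integrable_def
    by (intro integral_mono) (auto simp: indicator_def)
  then have "\<bar>LBINT t=ereal 0..ereal u. jacobi_integrand 1 t\<bar> \<le> K"
    unfolding K_def interval_integral_abs[OF nonneg] A_def .
  then show False
    using v integral_modulus_1_arctan_sinh(2)[of v] by (simp add: u_def)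
qed

section \<open>Derivatives of the amplitude and of cn\<close>

lemma jacobi_am_has_derivative:
  assumes "0 \<le> m" "m \<le> 1"
  shows "0 < 1 - m\<^sup>2 * (sin (jacobi_am v m))\<^sup>2"
    and "((\<lambda>v. jacobi_am v m) has_real_derivative sqrt (1 - m\<^sup>2 * (sin (jacobi_am v m))\<^sup>2)) (at v)"
proof -
  have "0 < 1 - m\<^sup>2 * (sin (jacobi_am v m))\<^sup>2 \<and>
    ((\<lambda>v. jacobi_am v m) has_real_derivative sqrt (1 - m\<^sup>2 * (sin (jacobi_am v m))\<^sup>2)) (at v)"
  proof (cases "m = 1")
    case True
    have c: "0 < cos t" if "t \<in> {- pi/2 <..< pi/2}" for t
      using that by (intro cos_gt_zero_pi) auto
    have s: "\<exists>\<phi>\<in>{- pi/2 <..< pi/2}. arsinh (tan \<phi>) = v" for v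
      using arctan_bounded[of "sinh v"]
      by (intro bexI[of _ "arctan (sinh v)"]) (auto simp: tan_arctan arsinh_sinh_real)
    have "is_interval {- pi/2 <..< pi/2}" "0 \<in> {- pi/2 <..< pi/2}"
      by (auto simp: is_interval_1)
    note * = jacobi_am_antiderivative[OF this cos_pos_imp_modulus_1(1)[OF c]
        arsinh_tan_has_derivative[OF c] _ s integrable_modulus_1, of v]
    show ?thesis using * c cos_pos_imp_modulus_1(1) True by simp
  next
    case False
    then have m: "m\<^sup>2 < 1" using assms by (simp add: power_less_one_iff abs_square_less_1)
    have pos: "0 < 1 - m\<^sup>2 * (sin t)\<^sup>2" for t
      using mult_left_mono[of "(sin t)\<^sup>2" 1 "m\<^sup>2"] m by (simp add: abs_square_le_1)
    \<comment> \<open>For \<open>m < 1\<close> the radicand never vanishes, so a global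
      antiderivative exists; \<open>E\<close> normalises it to vanish at 0, the lower limit of
      integration.\<close>
    obtain F where "\<And>x. (F has_vector_derivative jacobi_integrand m x) (at x)"
      using einterval_antiderivative[of "-\<infinity>" "\<infinity>" "jacobi_integrand m"]
        isCont_jacobi_integrand[OF pos] by auto
    then have F: "(F has_real_derivative jacobi_integrand m x) (at x)" for x
      by (simp add: has_real_derivative_iff_has_vector_derivative)
    define E where "E x = F x - F 0" for x
    have E: "(E has_real_derivative jacobi_integrand m x) (at x)" for x
      unfolding E_def[abs_def] using F[of x] by (auto intro!: derivative_eq_intros)
    have grow: "y - x \<le> E y - E x" if "x < y" for x y
    proof -
      obtain z where "E y - E x = (y - x) * jacobi_integrand m z"
        using MVT2[of x y E "jacobi_integrand m"] \<open>x < y\<close> E by blast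
      then show ?thesis
        using jacobi_integrand_ge_1[OF pos[of z]] mult_left_mono[of 1 "jacobi_integrand m z" "y - x"] that
        by auto
    qed
    have s: "\<exists>\<phi>\<in>UNIV. E \<phi> = v" for v
    proof -
      \<comment> \<open>As \<open>E\<close> vanishes at 0 and has slope at least 1, its values at
        \<open>\<bar>v\<bar> + 1\<close> and \<open>- \<bar>v\<bar> - 1\<close> enclose
        \<open>v\<close>.\<close>
      have "E (- \<bar>v\<bar> - 1) \<le> v" "v \<le> E (\<bar>v\<bar> + 1)"
        using grow[of "- \<bar>v\<bar> - 1" 0] grow[of 0 "\<bar>v\<bar> + 1"] E_def[of 0] by linarith+
      then show ?thesis
        using IVT[of E "- \<bar>v\<bar> - 1" v "\<bar>v\<bar> + 1"] DERIV_isCont[OF E] by auto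
    qed
    show ?thesis
      using jacobi_am_antiderivative[of UNIV m E v] pos E s by (auto simp: E_def)
  qed
  then show "0 < 1 - m\<^sup>2 * (sin (jacobi_am v m))\<^sup>2"
    "((\<lambda>v. jacobi_am v m) has_real_derivative sqrt (1 - m\<^sup>2 * (sin (jacobi_am v m))\<^sup>2)) (at v)"
    by auto
qed

text \<open>The witness for \<open>cn'\<close> is \<open>- sn v * dn v\<close>. Only these three
  relations are needed later: they express every higher derivative of cn as a polynomial in cn,
  possibly times \<open>cn'\<close>.\<close>

lemma jacobi_cn_has_derivatives:
  assumes "0 \<le> m" "m \<le> 1"
  obtains cn' where
    "\<And>v. ((\<lambda>v. jacobi_cn v m) has_real_derivative cn' v) (at v)"
    "\<And>v. (cn' has_real_derivative
        (2 * m\<^sup>2 - 1) * jacobi_cn v m - 2 * m\<^sup>2 * (jacobi_cn v m)^3) (at v)"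
    "\<And>v. (cn' v)\<^sup>2 = (1 - (jacobi_cn v m)\<^sup>2) * (1 - m\<^sup>2 + m\<^sup>2 * (jacobi_cn v m)\<^sup>2)"
proof
  define sn dn where "sn v = sin (jacobi_am v m)"
    and "dn v = sqrt (1 - m\<^sup>2 * (sin (jacobi_am v m))\<^sup>2)" for v
  note am = jacobi_am_has_derivative[OF assms]
  have dn0: "dn v > 0" and dn2: "(dn v)\<^sup>2 = 1 - m\<^sup>2 * (sn v)\<^sup>2" for v
    using am(1)[of v] by (auto simp: dn_def sn_def)
  have sn2: "(sn v)\<^sup>2 = 1 - (jacobi_cn v m)\<^sup>2" for v
    by (simp add: sn_def jacobi_cn_def sin_squared_eq)
  have cn: "((\<lambda>v. jacobi_cn v m) has_real_derivative - sn v * dn v) (at v)" for v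
    unfolding jacobi_cn_def sn_def dn_def by (auto intro!: derivative_eq_intros am(2))
  have sn: "(sn has_real_derivative jacobi_cn v m * dn v) (at v)" for v
    unfolding jacobi_cn_def sn_def[abs_def] dn_def by (auto intro!: derivative_eq_intros am(2))
  have dn: "(dn has_real_derivative - m\<^sup>2 * sn v * jacobi_cn v m) (at v)" for v
  proof -
    have "((\<lambda>v. 1 - m\<^sup>2 * (sn v)\<^sup>2) has_real_derivative
        - (m\<^sup>2 * (2 * sn v * (jacobi_cn v m * dn v)))) (at v)"
      by (auto intro!: derivative_eq_intros sn)
    \<comment> \<open>The square root is differentiable here because the radicand stays positive
      along the amplitude, also for \<open>m = 1\<close>.\<close>
    from DERIV_chain2[OF DERIV_real_sqrt this]
    have "((\<lambda>v. sqrt (1 - m\<^sup>2 * (sn v)\<^sup>2)) has_real_derivative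
        inverse (dn v) / 2 * - (m\<^sup>2 * (2 * sn v * (jacobi_cn v m * dn v)))) (at v)"
      using am(1)[of v] by (simp add: sn_def dn_def)
    then show ?thesis
      using dn0[of v] unfolding dn_def[abs_def] sn_def[symmetric] by (simp add: field_simps)
  qed
  show "((\<lambda>v. jacobi_cn v m) has_real_derivative - sn v * dn v) (at v)" for v
    by (rule cn)
  have "((\<lambda>v. - sn v * dn v) has_real_derivative
      - (jacobi_cn v m * (dn v)\<^sup>2) + m\<^sup>2 * (sn v)\<^sup>2 * jacobi_cn v m) (at v)" for v
    by (auto intro!: derivative_eq_intros sn dn simp: power2_eq_square)
  then show "((\<lambda>v. - sn v * dn v) has_real_derivative
      (2 * m\<^sup>2 - 1) * jacobi_cn v m - 2 * m\<^sup>2 * (jacobi_cn v m)^3) (at v)" for v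
    unfolding dn2 sn2 by (simp add: algebra_simps power2_eq_square power3_eq_cube)
  show "(- sn v * dn v)\<^sup>2 = (1 - (jacobi_cn v m)\<^sup>2) * (1 - m\<^sup>2 + m\<^sup>2 * (jacobi_cn v m)\<^sup>2)" for v
    by (simp add: power_mult_distrib dn2 sn2 algebra_simps)
qed

section \<open>Cnoidal profiles\<close>

text \<open>\<open>F i\<close> and \<open>G i\<close> stand for the \<open>i\<close>-th derivatives
  of the profiles. Each time derivative contributes a factor \<open>- s\<close>, which turns the
  mixed terms into \<open>+ b * s * F 3 y\<close> and \<open>+ d * s * G 3 y\<close>.\<close>

lemma travelling_wave_profile:
  fixes F G :: "nat \<Rightarrow> real \<Rightarrow> real"
  assumes F: "\<And>i y. i < 3 \<Longrightarrow> (F i has_real_derivative F (Suc i) y) (at y)"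
      "continuous_on UNIV (F 3)"
    and G: "\<And>i y. i < 3 \<Longrightarrow> (G i has_real_derivative G (Suc i) y) (at y)"
      "continuous_on UNIV (G 3)"
    and eq1: "\<And>y. - s * F 1 y + G 1 y + (G 1 y * F 0 y + G 0 y * F 1 y)
                + a * G 3 y + b * s * F 3 y = 0"
    and eq2: "\<And>y. - s * G 1 y + F 1 y + G 0 y * G 1 y + c * F 3 y + d * s * G 3 y = 0"
  shows "travelling_wave_solution a b c d s (\<lambda>x t. F 0 (x - s * t)) (\<lambda>x t. G 0 (x - s * t))"
proof -
  have "\<And>y. ((\<lambda>y. G 0 y * F 0 y) has_real_derivative G 1 y * F 0 y + G 0 y * F 1 y) (at y)"
    using F(1)[of 0] G(1)[of 0] by (auto intro!: derivative_eq_intros)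
  note prod = partial_travelling(1)[OF this, of s]
  have dF: "\<And>y. (F 0 has_real_derivative F 1 y) (at y)" "\<And>y. (F 1 has_real_derivative F 2 y) (at y)"
      "\<And>y. (F 2 has_real_derivative F 3 y) (at y)"
    and dG: "\<And>y. (G 0 has_real_derivative G 1 y) (at y)" "\<And>y. (G 1 has_real_derivative G 2 y) (at y)"
      "\<And>y. (G 2 has_real_derivative G 3 y) (at y)"
    using F(1)[of 0] F(1)[of 1] F(1)[of 2] G(1)[of 0] G(1)[of 1] G(1)[of 2]
    by (simp_all add: eval_nat_numeral)
  \<comment> \<open>The factor \<open>- s\<close> is put back next to the third derivative, to match
    the form that rewriting the mixed partial derivatives produces.\<close>
  have eq1': "- s * F 1 y + G 1 y + (G 1 y * F 0 y + G 0 y * F 1 y) + a * G 3 y - b * (- s * F 3 y) = 0"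
    and eq2': "- s * G 1 y + F 1 y + G 0 y * G 1 y + c * F 3 y - d * (- s * G 3 y) = 0" for y
    using eq1[of y] eq2[of y] by simp_all
  have "abcd_solution a b c d (\<lambda>x t. F 0 (x - s * t)) (\<lambda>x t. G 0 (x - s * t))"
    unfolding abcd_solution_def prod
      partial_travelling[OF dF(1)] partial_travelling[OF dF(2)] partial_travelling[OF dF(3)]
      partial_travelling[OF dG(1)] partial_travelling[OF dG(2)] partial_travelling[OF dG(3)]
      eq1' eq2'
    using Ck_plane_travelling[of 3 F 1 s, OF F] Ck_plane_travelling[of 3 G 1 s, OF G]
    by simp
  then show ?thesis
    unfolding travelling_wave_solution_def by blast
qed

text \<open>The \<open>i\<close>-th derivative of \<open>p0 + p1 C(l y) + p2 C(l y)\<^sup>2\<close>, reduced by means of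
  \<open>C'\<^sup>2 = (1 - C\<^sup>2) (1 - m\<^sup>2 + m\<^sup>2 C\<^sup>2)\<close>; only \<open>i \<le> 3\<close> is meaningful.\<close>

definition cnoidal ::
    "(real \<Rightarrow> real) \<Rightarrow> (real \<Rightarrow> real) \<Rightarrow> real \<Rightarrow> real \<Rightarrow> real \<Rightarrow> real \<Rightarrow> real \<Rightarrow> nat \<Rightarrow> real \<Rightarrow> real"
  where "cnoidal C C' m l p0 p1 p2 i y = (let u = C (l * y); u' = C' (l * y) in
    if i = 0 then p0 + p1 * u + p2 * u\<^sup>2
    else if i = 1 then l * (p1 + 2 * p2 * u) * u'
    else if i = 2 then l\<^sup>2 * (2 * p2 * (1 - m\<^sup>2) + p1 * (2 * m\<^sup>2 - 1) * u
      + 4 * p2 * (2 * m\<^sup>2 - 1) * u\<^sup>2 - 2 * m\<^sup>2 * p1 * u^3 - 6 * m\<^sup>2 * p2 * u^4)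
    else l^3 * (p1 * (2 * m\<^sup>2 - 1) + 8 * p2 * (2 * m\<^sup>2 - 1) * u
      - 6 * m\<^sup>2 * p1 * u\<^sup>2 - 24 * m\<^sup>2 * p2 * u^3) * u')"

text \<open>Entries 0 and 2 are polynomials in \<open>C\<close>, so the chain rule suffices for
  them. Only the passage from entry 1 to entry 2 meets the second derivative of \<open>C\<close> and
  the square of \<open>C'\<close>, which the hypotheses replace by polynomials in
  \<open>C\<close>.\<close>

lemma
  assumes C: "\<And>v. (C has_real_derivative C' v) (at v)"
    and C': "\<And>v. (C' has_real_derivative (2 * m\<^sup>2 - 1) * C v - 2 * m\<^sup>2 * (C v)^3) (at v)"
    and C'2: "\<And>v. (C' v)\<^sup>2 = (1 - (C v)\<^sup>2) * (1 - m\<^sup>2 + m\<^sup>2 * (C v)\<^sup>2)"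
  shows cnoidal_has_derivative:
      "i < 3 \<Longrightarrow> (cnoidal C C' m l p0 p1 p2 i has_real_derivative
         cnoidal C C' m l p0 p1 p2 (Suc i) y) (at y)"
    and continuous_on_cnoidal: "continuous_on UNIV (cnoidal C C' m l p0 p1 p2 3)"
proof -
  define U U' where "U y = C (l * y)" and "U' y = C' (l * y)" for y
  note cn = ext[OF cnoidal_def[of C C' m l p0 p1 p2, folded U_def U'_def, unfolded Let_def]]
  have u: "(U has_real_derivative U' y * l) (at y)"
    and u': "(U' has_real_derivative ((2 * m\<^sup>2 - 1) * U y - 2 * m\<^sup>2 * (U y)^3) * l) (at y)"
    for y
    unfolding U_def[abs_def] U'_def[abs_def]
    by (rule DERIV_chain2[OF C] DERIV_chain2[OF C'], auto intro!: derivative_eq_intros)+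
  have u'2: "(U' y)\<^sup>2 = (1 - (U y)\<^sup>2) * (1 - m\<^sup>2 + m\<^sup>2 * (U y)\<^sup>2)" for y
    unfolding U_def U'_def by (rule C'2)
  show "continuous_on UNIV (cnoidal C C' m l p0 p1 p2 3)"
    unfolding cn using DERIV_isCont[OF u] DERIV_isCont[OF u']
    by (auto intro!: continuous_intros continuous_at_imp_continuous_on)
  assume "i < 3"
  then consider "i = 0" | "i = 1" | "i = 2" by linarith
  then show "(cnoidal C C' m l p0 p1 p2 i has_real_derivative
      cnoidal C C' m l p0 p1 p2 (Suc i) y) (at y)"
  proof cases
    case 1
    then show ?thesis
      unfolding cn by (auto intro!: derivative_eq_intros u simp: algebra_simps)
  next
    case 2
    have "((\<lambda>y. l * (p1 + 2 * p2 * U y) * U' y) has_real_derivative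
        l\<^sup>2 * (2 * p2 * (U' y)\<^sup>2
          + (p1 + 2 * p2 * U y) * ((2 * m\<^sup>2 - 1) * U y - 2 * m\<^sup>2 * (U y)^3))) (at y)"
      by (auto intro!: derivative_eq_intros u u' simp: algebra_simps power2_eq_square)
    then show ?thesis
      unfolding cn u'2 using 2
      by (simp add: algebra_simps power2_eq_square power3_eq_cube power4_eq_xxxx)
  next
    case 3
    then show ?thesis
      unfolding cn
      by (auto intro!: derivative_eq_intros u
          simp: algebra_simps power2_eq_square power3_eq_cube)
  qed
qed

text \<open>The hypotheses \<open>eq1\<close> and \<open>eq2\<close> are the coefficients of the two
  cubics in ascending powers of \<open>u\<close>, with the numerical factors 1, 2, 3, 4 and 1, 1, 3,
  2 removed.\<close>

lemma cnoidal_travelling_wave: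
  assumes "0 \<le> m" "m \<le> 1" and M: "M = 2 * m\<^sup>2 - 1" and L: "L = l\<^sup>2"
    and eq1: "- s * j1 + k1 + k0 * j1 + k1 * j0 + L * M * (a * k1 + b * s * j1) = 0"
      "- s * j2 + k2 + k0 * j2 + k1 * j1 + k2 * j0 + 4 * L * M * (a * k2 + b * s * j2) = 0"
      "k1 * j2 + k2 * j1 - 2 * m\<^sup>2 * L * (a * k1 + b * s * j1) = 0"
      "k2 * j2 - 6 * m\<^sup>2 * L * (a * k2 + b * s * j2) = 0"
    and eq2: "- s * k1 + j1 + k0 * k1 + L * M * (c * j1 + d * s * k1) = 0"
      "2 * (- s * k2 + j2 + k0 * k2) + k1\<^sup>2 + 8 * L * M * (c * j2 + d * s * k2) = 0"
      "k1 * k2 - 2 * m\<^sup>2 * L * (c * j1 + d * s * k1) = 0"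
      "k2\<^sup>2 - 12 * m\<^sup>2 * L * (c * j2 + d * s * k2) = 0"
  shows "travelling_wave_solution a b c d s
      (\<lambda>x t. j0 + j1 * jacobi_cn (l * (x - s * t)) m + j2 * (jacobi_cn (l * (x - s * t)) m)\<^sup>2)
      (\<lambda>x t. k0 + k1 * jacobi_cn (l * (x - s * t)) m + k2 * (jacobi_cn (l * (x - s * t)) m)\<^sup>2)"
proof -
  define C where "C v = jacobi_cn v m" for v
  obtain C' where C': "\<And>v. (C has_real_derivative C' v) (at v)"
    "\<And>v. (C' has_real_derivative (2 * m\<^sup>2 - 1) * C v - 2 * m\<^sup>2 * (C v)^3) (at v)"
    "\<And>v. (C' v)\<^sup>2 = (1 - (C v)\<^sup>2) * (1 - m\<^sup>2 + m\<^sup>2 * (C v)\<^sup>2)"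
    using jacobi_cn_has_derivatives[OF assms(1,2)] unfolding C_def[abs_def] by metis
  have "travelling_wave_solution a b c d s
      (\<lambda>x t. cnoidal C C' m l j0 j1 j2 0 (x - s * t)) (\<lambda>x t. cnoidal C C' m l k0 k1 k2 0 (x - s * t))"
  proof (rule travelling_wave_profile)
    fix y
    \<comment> \<open>With one factor \<open>l\<close> absorbed into \<open>u'\<close>, the third
      derivative keeps only \<open>l\<^sup>2 = L\<close>, so the identities below are polynomial in
      \<open>L\<close>.\<close>
    define u u' where "u = C (l * y)" and "u' = l * C' (l * y)"
    have cn: "cnoidal C C' m l p0 p1 p2 0 y = p0 + p1 * u + p2 * u\<^sup>2"
      "cnoidal C C' m l p0 p1 p2 1 y = u' * (p1 + 2 * p2 * u)"
      "cnoidal C C' m l p0 p1 p2 3 y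
        = u' * (L * (p1 * M + 8 * p2 * M * u - 6 * m\<^sup>2 * p1 * u\<^sup>2 - 24 * m\<^sup>2 * p2 * u^3))"
      for p0 p1 p2
      by (simp_all add: cnoidal_def Let_def u_def u'_def M L power2_eq_square power3_eq_cube)
    have "- s * (j1 + 2 * j2 * u) + (k1 + 2 * k2 * u)
        + ((k1 + 2 * k2 * u) * (j0 + j1 * u + j2 * u\<^sup>2) + (k0 + k1 * u + k2 * u\<^sup>2) * (j1 + 2 * j2 * u))
        + a * (L * (k1 * M + 8 * k2 * M * u - 6 * m\<^sup>2 * k1 * u\<^sup>2 - 24 * m\<^sup>2 * k2 * u^3))
        + b * s * (L * (j1 * M + 8 * j2 * M * u - 6 * m\<^sup>2 * j1 * u\<^sup>2 - 24 * m\<^sup>2 * j2 * u^3))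
      = (- s * j1 + k1 + k0 * j1 + k1 * j0 + L * M * (a * k1 + b * s * j1))
        + 2 * u * (- s * j2 + k2 + k0 * j2 + k1 * j1 + k2 * j0 + 4 * L * M * (a * k2 + b * s * j2))
        + 3 * u\<^sup>2 * (k1 * j2 + k2 * j1 - 2 * m\<^sup>2 * L * (a * k1 + b * s * j1))
        + 4 * u^3 * (k2 * j2 - 6 * m\<^sup>2 * L * (a * k2 + b * s * j2))" (is "?p = _")
      by algebra
    then have p: "?p = 0" unfolding eq1 by simp
    have "- s * cnoidal C C' m l j0 j1 j2 1 y + cnoidal C C' m l k0 k1 k2 1 y
        + (cnoidal C C' m l k0 k1 k2 1 y * cnoidal C C' m l j0 j1 j2 0 y
          + cnoidal C C' m l k0 k1 k2 0 y * cnoidal C C' m l j0 j1 j2 1 y)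
        + a * cnoidal C C' m l k0 k1 k2 3 y + b * s * cnoidal C C' m l j0 j1 j2 3 y
      = u' * ?p"
      unfolding cn by algebra
    then show "- s * cnoidal C C' m l j0 j1 j2 1 y + cnoidal C C' m l k0 k1 k2 1 y
        + (cnoidal C C' m l k0 k1 k2 1 y * cnoidal C C' m l j0 j1 j2 0 y
          + cnoidal C C' m l k0 k1 k2 0 y * cnoidal C C' m l j0 j1 j2 1 y)
        + a * cnoidal C C' m l k0 k1 k2 3 y + b * s * cnoidal C C' m l j0 j1 j2 3 y = 0"
      unfolding p by simp
    have "- s * (k1 + 2 * k2 * u) + (j1 + 2 * j2 * u)
        + (k0 + k1 * u + k2 * u\<^sup>2) * (k1 + 2 * k2 * u)
        + c * (L * (j1 * M + 8 * j2 * M * u - 6 * m\<^sup>2 * j1 * u\<^sup>2 - 24 * m\<^sup>2 * j2 * u^3))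
        + d * s * (L * (k1 * M + 8 * k2 * M * u - 6 * m\<^sup>2 * k1 * u\<^sup>2 - 24 * m\<^sup>2 * k2 * u^3))
      = (- s * k1 + j1 + k0 * k1 + L * M * (c * j1 + d * s * k1))
        + u * (2 * (- s * k2 + j2 + k0 * k2) + k1\<^sup>2 + 8 * L * M * (c * j2 + d * s * k2))
        + 3 * u\<^sup>2 * (k1 * k2 - 2 * m\<^sup>2 * L * (c * j1 + d * s * k1))
        + 2 * u^3 * (k2\<^sup>2 - 12 * m\<^sup>2 * L * (c * j2 + d * s * k2))" (is "?q = _")
      by algebra
    then have q: "?q = 0" unfolding eq2 by simp
    have "- s * cnoidal C C' m l k0 k1 k2 1 y + cnoidal C C' m l j0 j1 j2 1 y
        + cnoidal C C' m l k0 k1 k2 0 y * cnoidal C C' m l k0 k1 k2 1 y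
        + c * cnoidal C C' m l j0 j1 j2 3 y + d * s * cnoidal C C' m l k0 k1 k2 3 y
      = u' * ?q"
      unfolding cn by algebra
    then show "- s * cnoidal C C' m l k0 k1 k2 1 y + cnoidal C C' m l j0 j1 j2 1 y
        + cnoidal C C' m l k0 k1 k2 0 y * cnoidal C C' m l k0 k1 k2 1 y
        + c * cnoidal C C' m l j0 j1 j2 3 y + d * s * cnoidal C C' m l k0 k1 k2 3 y = 0"
      unfolding q by simp
  qed (use cnoidal_has_derivative[OF C'] continuous_on_cnoidal[OF C'] in auto)
  then show ?thesis
    by (simp add: cnoidal_def C_def Let_def)
qed

section \<open>The algebraic identities for the coefficients\<close>

text \<open>\<open>j1\<close> and \<open>k1\<close> are linear in \<open>X\<close> and the other
  data are free of it. Hence the coefficients of even powers of \<open>u\<close> are multiples of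
  \<open>X\<close>, while those of odd powers contain \<open>X\<close> only through its square,
  which is rational in the parameters.\<close>

lemma abcd_cnoidal_coefficients:
  fixes a b c d m s j0 j1 j2 k0 k1 k2 L M P X :: real
  assumes P: "P = 3*b + 2*d"
    and L: "L = - (3 * P / (2 * c * M * (b + 2*d)))"
    and X: "X\<^sup>2 = P * (b - d) / M"
    and a: "a = - (s\<^sup>2 * (b - 6*d) * (3*b - 2*d) / (32 * c))"
    and j0: "j0 = - 1 + s\<^sup>2 * P * (21*b - 46*d) / (64 * c\<^sup>2)"
    and j1: "j1 = 3 * m * P * X * s\<^sup>2 / (8 * c\<^sup>2)"
    and j2: "j2 = - (9 * m\<^sup>2 * P * (b - 6*d) * s\<^sup>2 / (32 * c\<^sup>2 * M))"
    and k0: "k0 = (21*b + 8*c + 14*d) * s / (8 * c)"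
    and k1: "k1 = 3 * m * s * X / (2 * c)"
    and k2: "k2 = - (9 * m\<^sup>2 * P * s / (4 * c * M))"
    and nz: "c \<noteq> 0" "M \<noteq> 0" "b + 2*d \<noteq> 0"
  shows "- s * j1 + k1 + k0 * j1 + k1 * j0 + L * M * (a * k1 + b * s * j1) = 0"
    and "- s * j2 + k2 + k0 * j2 + k1 * j1 + k2 * j0 + 4 * L * M * (a * k2 + b * s * j2) = 0"
    and "k1 * j2 + k2 * j1 - 2 * m\<^sup>2 * L * (a * k1 + b * s * j1) = 0"
    and "k2 * j2 - 6 * m\<^sup>2 * L * (a * k2 + b * s * j2) = 0"
    and "- s * k1 + j1 + k0 * k1 + L * M * (c * j1 + d * s * k1) = 0"
    and "2 * (- s * k2 + j2 + k0 * k2) + k1\<^sup>2 + 8 * L * M * (c * j2 + d * s * k2) = 0"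
    and "k1 * k2 - 2 * m\<^sup>2 * L * (c * j1 + d * s * k1) = 0"
    and "k2\<^sup>2 - 12 * m\<^sup>2 * L * (c * j2 + d * s * k2) = 0"
proof -
  \<comment> \<open>These are the only two products in the eight identities that are quadratic in
    \<open>X\<close>, so the relation for \<open>X\<^sup>2\<close> is used nowhere else.\<close>
  have kj: "k1 * j1 = 9 * m\<^sup>2 * P * s^3 / (16 * c^3) * (P * (b - d) / M)"
    and kk: "k1\<^sup>2 = 9 * m\<^sup>2 * s\<^sup>2 / (4 * c\<^sup>2) * (P * (b - d) / M)"
    unfolding X[symmetric] j1 k1
    by (simp_all add: power2_eq_square power3_eq_cube mult_ac)
  have LZ: "L * (r * (b + 2*d)) = - (3 * P * r / (2 * c * M))" for r
    unfolding L using nz(3) by simp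
  text \<open>Each of the four combinations has the factor \<open>b + 2 d\<close>, cancelling that of \<open>L\<close>.\<close>
  have "a * k1 + b * s * j1 = 9 * m * X * s^3 * (7*b - 2*d) / (64 * c\<^sup>2) * (b + 2*d)"
    unfolding a k1 j1 P using nz(1)
    by (simp add: field_simps power2_eq_square power3_eq_cube)
  then have A1: "L * (a * k1 + b * s * j1)
      = - (27 * m * X * P * s^3 * (7*b - 2*d) / (128 * c^3 * M))"
    using nz by (simp only: LZ) (simp add: field_simps power2_eq_square power3_eq_cube)
  have "a * k2 + b * s * j2 = - (9 * m\<^sup>2 * P * s^3 * (b - 6*d) / (128 * c\<^sup>2 * M)) * (b + 2*d)"
    unfolding a k2 j2 using nz(1,2)
    by (simp add: field_simps power2_eq_square power3_eq_cube)
  then have A2: "L * (a * k2 + b * s * j2)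
      = 27 * m\<^sup>2 * P\<^sup>2 * s^3 * (b - 6*d) / (256 * c^3 * M\<^sup>2)"
    using nz by (simp only: LZ) (simp add: field_simps power2_eq_square power3_eq_cube)
  have "c * j1 + d * s * k1 = 9 * m * X * s\<^sup>2 / (8 * c) * (b + 2*d)"
    unfolding k1 j1 P using nz(1)
    by (simp add: field_simps power2_eq_square)
  then have C1: "L * (c * j1 + d * s * k1) = - (27 * m * X * P * s\<^sup>2 / (16 * c\<^sup>2 * M))"
    using nz by (simp only: LZ) (simp add: field_simps power2_eq_square)
  have "c * j2 + d * s * k2 = - (9 * m\<^sup>2 * P * s\<^sup>2 / (32 * c * M)) * (b + 2*d)"
    unfolding k2 j2 using nz(1,2)
    by (simp add: field_simps power2_eq_square)
  then have C2: "L * (c * j2 + d * s * k2) = 27 * m\<^sup>2 * P\<^sup>2 * s\<^sup>2 / (64 * c\<^sup>2 * M\<^sup>2)"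
    using nz by (simp only: LZ) (simp add: field_simps power2_eq_square)
  \<comment> \<open>Regrouping exposes the products \<open>A1\<close>, \<open>A2\<close>,
    \<open>C1\<close> and \<open>C2\<close>. They must be rewritten before the amplitudes are
    unfolded, so that the denominator \<open>b + 2*d\<close> is gone when the fractions are
    cleared.\<close>
  have assoc: "t * L * M * r = t * M * (L * r)" "L * M * r = M * (L * r)" "t * L * r = t * (L * r)"
    for t r
    by simp_all
  show "- s * j1 + k1 + k0 * j1 + k1 * j0 + L * M * (a * k1 + b * s * j1) = 0"
    unfolding assoc(1,2) A1 unfolding j0 j1 k0 k1 P using nz(1,2)
    by (simp add: field_simps power2_eq_square power3_eq_cube)
  show "- s * j2 + k2 + k0 * j2 + k1 * j1 + k2 * j0 + 4 * L * M * (a * k2 + b * s * j2) = 0"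
    unfolding assoc(1,2) A2 kj unfolding j0 j2 k0 k2 P using nz(1,2)
    by (simp add: field_simps power2_eq_square power3_eq_cube)
  show "k1 * j2 + k2 * j1 - 2 * m\<^sup>2 * L * (a * k1 + b * s * j1) = 0"
    unfolding assoc(3) A1 unfolding j1 j2 k1 k2 P using nz(1,2)
    by (simp add: field_simps power2_eq_square power3_eq_cube)
  show "k2 * j2 - 6 * m\<^sup>2 * L * (a * k2 + b * s * j2) = 0"
    unfolding assoc(3) A2 unfolding j2 k2 P using nz(1,2)
    by (simp add: field_simps power2_eq_square power3_eq_cube)
  show "- s * k1 + j1 + k0 * k1 + L * M * (c * j1 + d * s * k1) = 0"
    unfolding assoc(1,2) C1 unfolding j1 k0 k1 P using nz(1,2)
    by (simp add: field_simps power2_eq_square)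
  show "2 * (- s * k2 + j2 + k0 * k2) + k1\<^sup>2 + 8 * L * M * (c * j2 + d * s * k2) = 0"
    unfolding assoc(1,2) C2 kk unfolding j2 k0 k2 P using nz(1,2)
    by (simp add: field_simps power2_eq_square)
  show "k1 * k2 - 2 * m\<^sup>2 * L * (c * j1 + d * s * k1) = 0"
    unfolding assoc(3) C1 unfolding k1 k2 P using nz(1,2)
    by (simp add: field_simps power2_eq_square power3_eq_cube)
  show "k2\<^sup>2 - 12 * m\<^sup>2 * L * (c * j2 + d * s * k2) = 0"
    unfolding assoc(3) C2 unfolding k2 P using nz(1,2)
    by (simp add: field_simps power2_eq_square)
qed

section \<open>Reduction of the stated data to rational form\<close>

theorem mainTheorem3:
  fixes a b c d m \<tau>1 \<tau>2 :: real
    and j0 j1 j2 k0 k1 k2 lam \<sigma> :: real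
    and \<eta> w :: "real \<Rightarrow> real \<Rightarrow> real"
  assumes "admissible a b c d"
    and "c \<noteq> 0"
    and "0 < m" and "m \<le> 1"
    and "\<tau>1 \<in> {1, -1}" and "\<tau>2 \<in> {1, -1}"
    and "a * c * (b - 6*d) * (3*b - 2*d) < 0"
    and "c * (2*m\<^sup>2 - 1) * (b + 2*d) * (3*b + 2*d) < 0"
    and "(2*m\<^sup>2 - 1) * (3*b + 2*d) * (b - d) \<ge> 0"
    and "(2*m\<^sup>2 - 1) * (3*b + 2*d) * (b - d) = 0 \<longrightarrow> b = d"
    and "j0 = - ((a * (3*b + 2*d) * (21*b - 46*d) + 2*c * (3*b - 2*d) * (b - 6*d))
                    / (2*c * (3*b - 2*d) * (b - 6*d)))"
    and "j1 = - \<tau>1 * \<tau>2 * ((12*a*m * (3*b + 2*d) * sqrt ((2*m\<^sup>2 - 1) * (3*b + 2*d) * (b - d)))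
                    / (c * (b - 6*d) * (3*b - 2*d) * (2*m\<^sup>2 - 1)))"
    and "j2 = (9*a*m\<^sup>2 * (3*b + 2*d)) / (c * (3*b - 2*d) * (2*m\<^sup>2 - 1))"
    and "k0 = \<tau>1 * (((21*b + 8*c + 14*d) * sqrt (-2*a*c * (b - 6*d) * (3*b - 2*d)))
                    / (2*c * (b - 6*d) * (3*b - 2*d)))"
    and "k1 = \<tau>2 * ((6*m * sqrt (-2*a*c * (b - 6*d) * (3*b - 2*d) * (2*m\<^sup>2 - 1) * (3*b + 2*d) * (b - d)))
                    / (c * (2*m\<^sup>2 - 1) * (b - 6*d) * (3*b - 2*d)))"
    and "k2 = - \<tau>1 * ((9*m\<^sup>2 * (3*b + 2*d) * sqrt (-2*a*c * (b - 6*d) * (3*b - 2*d)))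
                    / (c * (2*m\<^sup>2 - 1) * (b - 6*d) * (3*b - 2*d)))"
    and "lam = 1/2 * sqrt ((-6 * (3*b + 2*d)) / (c * (2*m\<^sup>2 - 1) * (b + 2*d)))"
    and "\<sigma> = \<tau>1 * ((4 * sqrt (-2*a*c * (b - 6*d) * (3*b - 2*d))) / ((b - 6*d) * (3*b - 2*d)))"
    and "\<eta> = (\<lambda>x t. j0 + j1 * jacobi_cn (lam * (x - \<sigma> * t)) m
                        + j2 * (jacobi_cn (lam * (x - \<sigma> * t)) m)\<^sup>2)"
    and "w = (\<lambda>x t. k0 + k1 * jacobi_cn (lam * (x - \<sigma> * t)) m
                        + k2 * (jacobi_cn (lam * (x - \<sigma> * t)) m)\<^sup>2)"
  shows "travelling_wave_solution a b c d \<sigma> \<eta> w"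
proof -
  define M P Q R where "M = 2*m\<^sup>2 - 1" and "P = 3*b + 2*d" and "Q = b - 6*d" and "R = 3*b - 2*d"
  \<comment> \<open>The square roots in the amplitudes and the speed all reduce to \<open>S\<close>,
    \<open>T\<close> and their product; \<open>X\<close> combines \<open>T\<close> with both
    signs.\<close>
  define S T where "S = sqrt (-2*a*c * (b - 6*d) * (3*b - 2*d))"
    and "T = sqrt ((2*m\<^sup>2 - 1) * (3*b + 2*d) * (b - d))"
  define X where "X = \<tau>1 * \<tau>2 * T / M"
  note defs = assms(11-18)[folded M_def P_def Q_def R_def]
  have c: "c \<noteq> 0" by fact
  have nz: "M \<noteq> 0" "P \<noteq> 0" "Q \<noteq> 0" "R \<noteq> 0" "b + 2*d \<noteq> 0"
    using assms(7,8) by (auto simp: M_def P_def Q_def R_def)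
  have \<tau>: "\<tau>1 * \<tau>1 = 1" "\<tau>2 * \<tau>2 = 1" "\<tau>1\<^sup>2 = 1" "\<tau>2\<^sup>2 = 1"
    using assms(5,6) by auto
  have S2: "S\<^sup>2 = -2*a*c*Q*R"
    using assms(7) unfolding S_def Q_def R_def by (subst real_sqrt_pow2) (auto simp: mult.assoc)
  have T2: "T\<^sup>2 = M*P*(b - d)"
    using assms(9) unfolding T_def M_def P_def by (subst real_sqrt_pow2) auto
  \<comment> \<open>The product rule for \<open>sqrt\<close> holds on all reals, so no sign
    condition on the factors is involved.\<close>
  have ST: "sqrt (-2*a*c*Q*R*M*P*(b - d)) = S * T"
    unfolding S_def T_def M_def P_def Q_def R_def real_sqrt_mult[symmetric] by (simp add: mult.assoc)
  have S': "sqrt (-2*a*c*Q*R) = S" and T': "sqrt (M*P*(b - d)) = T"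
    by (simp_all add: S_def T_def M_def P_def Q_def R_def)
  have \<sigma>: "\<sigma> = \<tau>1 * (4 * S / (Q * R))"
    using defs(8) unfolding S' .
  then have "\<sigma>\<^sup>2 = 16 * S\<^sup>2 / (Q * R)\<^sup>2"
    by (simp add: power_mult_distrib power_divide \<tau>)
  then have \<sigma>2: "\<sigma>\<^sup>2 = - 32 * a * c / (Q * R)"
    unfolding S2 using nz by (simp add: field_simps power2_eq_square)
  \<comment> \<open>Solving the formula for \<open>\<sigma>\<^sup>2\<close> for \<open>a\<close>
    removes \<open>a\<close> in favour of the speed.\<close>
  have a: "a = - (\<sigma>\<^sup>2 * Q * R / (32 * c))"
    unfolding \<sigma>2 using nz c by (simp add: field_simps)
  have X2: "X\<^sup>2 = P * (b - d) / M"
    unfolding X_def using nz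
    by (simp add: power_mult_distrib power_divide \<tau> T2) (simp add: field_simps power2_eq_square)
  have j0: "j0 = - 1 + \<sigma>\<^sup>2 * P * (21*b - 46*d) / (64 * c\<^sup>2)"
    unfolding defs(1) \<sigma>2 using nz c by (simp add: field_simps power2_eq_square)
  have j1: "j1 = 3 * m * P * X * \<sigma>\<^sup>2 / (8 * c\<^sup>2)"
    unfolding defs(2) T' X_def \<sigma>2 using nz c by (simp add: field_simps power2_eq_square)
  have j2: "j2 = - (9 * m\<^sup>2 * P * Q * \<sigma>\<^sup>2 / (32 * c\<^sup>2 * M))"
    unfolding defs(3) \<sigma>2 using nz c by (simp add: field_simps power2_eq_square)
  have k0: "k0 = (21*b + 8*c + 14*d) * \<sigma> / (8 * c)"
    unfolding defs(4) S' \<sigma> using nz c by (simp add: field_simps)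
  \<comment> \<open>Both \<open>\<sigma>\<close> and \<open>X\<close> carry \<open>\<tau>1\<close>;
    its square is 1, which leaves \<open>\<tau>2\<close> as the sign of \<open>k1\<close>.\<close>
  have k1: "k1 = 3 * m * \<sigma> * X / (2 * c)"
    unfolding defs(5) ST X_def \<sigma> using nz c \<tau> by (simp add: field_simps)
  have k2: "k2 = - (9 * m\<^sup>2 * P * \<sigma> / (4 * c * M))"
    unfolding defs(6) S' \<sigma> using nz c by (simp add: field_simps)
  \<comment> \<open>The second strict inequality makes the radicand of \<open>lam\<close>
    nonnegative. For a negative radicand, squaring the total function \<open>sqrt\<close> would give
    its absolute value and the wrong sign of \<open>L\<close>.\<close>
  have pos: "0 \<le> (-6 * P) / (c * M * (b + 2*d))"
  proof -
    have "x * y < 0 \<Longrightarrow> 0 \<le> (-6 * y) / x" for x y :: real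
      by (auto simp: divide_le_0_iff mult_less_0_iff)
    moreover have "(c * M * (b + 2*d)) * P < 0"
      using assms(8) by (simp add: M_def P_def)
    ultimately show ?thesis .
  qed
  have L: "- (3 * P / (2 * c * M * (b + 2*d))) = lam\<^sup>2"
    unfolding defs(7) power_mult_distrib real_sqrt_pow2[OF pos] by (simp add: power2_eq_square)
  note eqs = abcd_cnoidal_coefficients[OF P_def L[symmetric] X2 a[unfolded Q_def R_def] j0 j1
      j2[unfolded Q_def] k0 k1 k2 c nz(1,5)]
  show ?thesis
    unfolding assms(19,20)
    by (rule cnoidal_travelling_wave[OF _ assms(4) M_def refl]) (use assms(3) eqs in simp_all)
qed

end
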